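(* Let $\ell_1,\ell_2,\ell_3$ be positive integers. There exists a flow-up class $\mathcal{G}_1=(0,g_2,g_3)$ on the edge-labeled triangle $(C_3,L)$ whose leading element is $g_2=\operatorname{lcm}(\ell_1,\gcd(\ell_2,\ell_3))$, and this is the smallest possible leading element: every flow-up class $(0,g_2',g_3')$ on $(C_3,L)$ with $g_2'>0$ satisfies $g_2'\ge \operatorname{lcm}(\ell_1,\gcd(\ell_2,\ell_3))$.
   Context: The edge-labeled triangle $(C_3,L)$ has vertices $v_1,v_2,v_3$, edge $v_1v_2$ labeled $\ell_1$, edge $v_2v_3$ labeled $\ell_2$, edge $v_3v_1$ labeled $\ell_3$. A generalized spline on $(C_3,L)$ is a triple $(g_1,g_2,g_3)\in\mathbb{Z}^3$ with $g_1\equiv g_2\pmod{\ell_1}$, $g_2\equiv g_3\pmod{\ell_2}$, $g_3\equiv g_1\pmod{\ell_3}$. A flow-up class $\mathcal{G}_1$ is a generalized spline of the form $(0,g_2,g_3)$ with $g_2\neq 0$. *)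

theory Defs
  imports "HOL-Number_Theory.Cong"
begin

text \<open>The labels \<open>l1\<close>, \<open>l2\<close>, \<open>l3\<close> belong to the edges \<open>v\<^sub>1v\<^sub>2\<close>, \<open>v\<^sub>2v\<^sub>3\<close>, \<open>v\<^sub>3v\<^sub>1\<close> respectively;
  the components of the triple are the values at \<open>v\<^sub>1\<close>, \<open>v\<^sub>2\<close>, \<open>v\<^sub>3\<close>.\<close>

definition triangle_spline :: "int \<Rightarrow> int \<Rightarrow> int \<Rightarrow> int \<times> int \<times> int \<Rightarrow> bool" where
  "triangle_spline l1 l2 l3 = (\<lambda>(g1, g2, g3).
     [g1 = g2] (mod l1) \<and> [g2 = g3] (mod l2) \<and> [g3 = g1] (mod l3))"

definition flow_up_class_1 :: "int \<Rightarrow> int \<Rightarrow> int \<Rightarrow> int \<times> int \<times> int \<Rightarrow> bool" where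
  "flow_up_class_1 l1 l2 l3 = (\<lambda>(g1, g2, g3).
     triangle_spline l1 l2 l3 (g1, g2, g3) \<and> g1 = 0 \<and> g2 \<noteq> 0)"

end

theory Submission
  imports Defs
begin

text \<open>Once \<open>g1 = 0\<close>, the value \<open>g3\<close> only has to satisfy
  \<open>g3\<close> = \<open>g2\<close> mod \<open>l2\<close> and \<open>g3\<close> = 0 mod
  \<open>l3\<close>. By the Chinese remainder criterion for arbitrary moduli
  (\<open>ex_cong_and_cong_0_iff_gcd_dvd\<close>) such a \<open>g3\<close> exists iff
  \<open>gcd l2 l3\<close> divides \<open>g2\<close>. Together with \<open>l1 dvd g2\<close>, the
  leading elements are exactly the nonzero multiples of \<open>lcm l1 (gcd l2 l3)\<close>, so the
  lcm is the least positive one.\<close>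

lemma ex_cong_and_cong_0_iff_gcd_dvd:
  fixes a m n :: int
  shows "(\<exists>x. [a = x] (mod m) \<and> [x = 0] (mod n)) \<longleftrightarrow> gcd m n dvd a"
proof
  assume "\<exists>x. [a = x] (mod m) \<and> [x = 0] (mod n)"
  then obtain x where "m dvd a - x" and "n dvd x"
    by (auto simp: cong_iff_dvd_diff)
  then have "gcd m n dvd (a - x) + x"
    by (meson dvd_add dvd_trans gcd_dvd1 gcd_dvd2)
  then show "gcd m n dvd a"
    by simp
next
  assume "gcd m n dvd a"
  then obtain k where "a = gcd m n * k" ..
  moreover obtain u v where "u * m + v * n = gcd m n"
    using bezout_int by blast
  ultimately have "a = m * (u * k) + n * (v * k)"
    by (metis (no_types) distrib_right mult.assoc mult.commute)
  \<comment> \<open>The witness is the \<open>n\<close>-part of the Bezout decomposition of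
    \<open>a\<close>: what remains of \<open>a\<close> is a multiple of \<open>m\<close>.\<close>
  then have "[a = n * (v * k)] (mod m) \<and> [n * (v * k) = 0] (mod n)"
    by (simp add: cong_iff_dvd_diff)
  then show "\<exists>x. [a = x] (mod m) \<and> [x = 0] (mod n)"
    by blast
qed

text \<open>Eliminates \<open>g3\<close>: the edge at \<open>l1\<close> and the solvability
  condition for \<open>g3\<close> are two divisibilities of \<open>g2\<close>, which merge into one
  by the lcm. Existence and minimality both follow from this.\<close>

lemma ex_flow_up_class_1_iff_lcm_dvd:
  "(\<exists>g3. flow_up_class_1 l1 l2 l3 (0, g2, g3)) \<longleftrightarrow> g2 \<noteq> 0 \<and> lcm l1 (gcd l2 l3) dvd g2"
proof -
  have "[0 = g2] (mod l1) \<longleftrightarrow> l1 dvd g2"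
    by (simp add: cong_iff_dvd_diff)
  then show ?thesis
    using ex_cong_and_cong_0_iff_gcd_dvd[of g2 l2 l3]
    by (auto simp: flow_up_class_1_def triangle_spline_def)
qed

theorem theorem3p2:
  fixes l1 l2 l3 :: int
  assumes "l1 > 0" and "l2 > 0" and "l3 > 0"
  shows "(\<exists>g2 g3. flow_up_class_1 l1 l2 l3 (0, g2, g3) \<and> g2 = lcm l1 (gcd l2 l3)) \<and>
         (\<forall>g2' g3'. flow_up_class_1 l1 l2 l3 (0, g2', g3') \<and> g2' > 0
            \<longrightarrow> g2' \<ge> lcm l1 (gcd l2 l3))"
proof (intro conjI allI impI)
  \<comment> \<open>Positive labels keep the lcm away from 0, as a leading element must be
    nonzero.\<close>
  have "lcm l1 (gcd l2 l3) \<noteq> 0"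
    using assms by (simp add: lcm_eq_0_iff)
  then show "\<exists>g2 g3. flow_up_class_1 l1 l2 l3 (0, g2, g3) \<and> g2 = lcm l1 (gcd l2 l3)"
    using ex_flow_up_class_1_iff_lcm_dvd[of l1 l2 l3 "lcm l1 (gcd l2 l3)"] by auto
next
  fix g2' g3'
  assume "flow_up_class_1 l1 l2 l3 (0, g2', g3') \<and> g2' > 0"
  then show "lcm l1 (gcd l2 l3) \<le> g2'"
    using ex_flow_up_class_1_iff_lcm_dvd[of l1 l2 l3 g2'] zdvd_imp_le by blast
qed

end
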